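(* Let $k \ge 1$ be an integer and let $\mathcal{G}$ be any family with $\mathcal{T} \subseteq \mathcal{G} \subseteq \mathcal{C}$. Then: (1) $k$ is forcing for $\mathcal{T}$ if and only if $k$ is forcing for $\mathcal{G}$. Furthermore, if $k$ is forcing for $\mathcal{G}$, then for every $t>0$ and for all but finitely many $G \in \mathcal{G}$, every $k$-local positive weighing $w$ of $G$ satisfies $w(G) \ge t$. (2) $k$ is weakly forcing for $\mathcal{T}$ if and only if $k$ is weakly forcing for $\mathcal{G}$, and (in that case) $f_{\mathcal{T}}(k)=f_{\mathcal{G}}(k)$. (3) $k$ collapses for $\mathcal{T}$ if and only if $k$ collapses for $\mathcal{G}$, and (in that case) $c_{\mathcal{T}}(k)=c_{\mathcal{G}}(k)$. Moreover, the same statements (1)–(3) hold with $\mathcal{T},\mathcal{G},\mathcal{C}$ replaced by $\mathcal{T}_\Delta,\mathcal{G}_\Delta,\mathcal{C}_\Delta$, for every family $\mathcal{G}_\Delta$ with $\mathcal{T}_\Delta \subseteq \mathcal{G}_\Delta \subseteq \mathcal{C}_\Delta$ and every $\Delta \ge k/2-1$.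
   Context: All graphs are finite and simple. For a graph $G$, a weighing is a function $w: E(G) \to \{-1,1\}$, and for a subgraph $H$, $w(H)=\sum_{e\in E(H)} w(e)$. For a positive integer $k$, $w$ is $k$-local positive if $w(H)>0$ for every connected subgraph $H$ of $G$ with exactly $k$ edges. Let $\mathcal{G}$ be an infinite family of connected graphs. $k$ is forcing for $\mathcal{G}$ if for all but finitely many $G \in \mathcal{G}$, every $k$-local positive weighing $w$ of $G$ satisfies $w(G)>0$. If $k$ is not forcing, $k$ is weakly forcing for $\mathcal{G}$ if there is a constant $C$ (possibly negative) such that for all but finitely many $G\in\mathcal{G}$, every $k$-local positive weighing $w$ of $G$ has $w(G)\ge C$; then $f_{\mathcal{G}}(k)$ is the maximum such $C$. If $k$ is neither forcing nor weakly forcing, $k$ collapses for $\mathcal{G}$, and $c_{\mathcal{G}}(k)$ is the supremum of all $c \le 0$ such that $w(G) \ge c|E(G)| - o(|E(G)|)$ for all $G \in \mathcal{G}$ and all $k$-local positive weighings $w$ of $G$. $\mathcal{C}$ is the family of all connected graphs, $\mathcal{T}$ the family of all trees; for a family $\mathcal{F}$, $\mathcal{F}_\Delta$ denotes its subfamily of members with maximum degree at most $\Delta$. *)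

theory Defs
  imports Complex_Main "HOL-Library.Landau_Symbols"
begin

text \<open>
  A graph is a pair of a vertex set and a set of two-element edges.  Every finite simple graph has
  a copy on natural-number vertices, so families of graphs are sets of graphs of this type, and
  ``all but finitely many members'' is counted up to isomorphism (see \<open>almost_all\<close> below).
\<close>

type_synonym graph = "nat set \<times> nat set set"

abbreviation verts :: "graph \<Rightarrow> nat set" where "verts G \<equiv> fst G"
abbreviation edges :: "graph \<Rightarrow> nat set set" where "edges G \<equiv> snd G"

definition simple_graph :: "graph \<Rightarrow> bool" where
  "simple_graph G \<longleftrightarrow> finite (verts G) \<and>
     edges G \<subseteq> {{u, v} | u v. u \<in> verts G \<and> v \<in> verts G \<and> u \<noteq> v}"

definition subgraph :: "graph \<Rightarrow> graph \<Rightarrow> bool" where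
  "subgraph H G \<longleftrightarrow> simple_graph H \<and> verts H \<subseteq> verts G \<and> edges H \<subseteq> edges G"

definition adjacency :: "graph \<Rightarrow> nat rel" where
  "adjacency G = {(u, v). {u, v} \<in> edges G}"

definition connected_graph :: "graph \<Rightarrow> bool" where
  "connected_graph G \<longleftrightarrow> simple_graph G \<and> verts G \<noteq> {} \<and>
     (\<forall>u \<in> verts G. \<forall>v \<in> verts G. (u, v) \<in> (adjacency G)\<^sup>*)"

definition is_cycle :: "graph \<Rightarrow> nat list \<Rightarrow> bool" where
  "is_cycle G vs \<longleftrightarrow> length vs \<ge> 3 \<and> distinct vs \<and>
     (\<forall>i < length vs. {vs ! i, vs ! (Suc i mod length vs)} \<in> edges G)"

definition is_tree :: "graph \<Rightarrow> bool" where
  "is_tree G \<longleftrightarrow> connected_graph G \<and> (\<nexists>vs. is_cycle G vs)"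

definition vertex_degree :: "graph \<Rightarrow> nat \<Rightarrow> nat" where
  "vertex_degree G v = card {e \<in> edges G. v \<in> e}"

definition max_degree :: "graph \<Rightarrow> nat" where
  "max_degree G = Max (vertex_degree G ` verts G)"

definition isomorphic :: "graph \<Rightarrow> graph \<Rightarrow> bool" where
  "isomorphic G H \<longleftrightarrow> (\<exists>\<phi>. bij_betw \<phi> (verts G) (verts H) \<and>
     (\<forall>u \<in> verts G. \<forall>v \<in> verts G. {u, v} \<in> edges G \<longleftrightarrow> {\<phi> u, \<phi> v} \<in> edges H))"

definition connected_graphs :: "graph set" where
  "connected_graphs = {G. connected_graph G}"

definition trees :: "graph set" where
  "trees = {G. is_tree G}"

definition restrict_degree :: "graph set \<Rightarrow> nat \<Rightarrow> graph set" where
  "restrict_degree F D = {G \<in> F. max_degree G \<le> D}"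

definition weighing :: "graph \<Rightarrow> (nat set \<Rightarrow> int) \<Rightarrow> bool" where
  "weighing G w \<longleftrightarrow> (\<forall>e \<in> edges G. w e \<in> {-1, 1})"

definition weight :: "(nat set \<Rightarrow> int) \<Rightarrow> graph \<Rightarrow> int" where
  "weight w H = (\<Sum>e \<in> edges H. w e)"

definition local_positive :: "nat \<Rightarrow> graph \<Rightarrow> (nat set \<Rightarrow> int) \<Rightarrow> bool" where
  "local_positive k G w \<longleftrightarrow> weighing G w \<and>
     (\<forall>H. subgraph H G \<and> connected_graph H \<and> card (edges H) = k \<longrightarrow> weight w H > 0)"

text \<open>
  One isomorphism class contains infinitely many labelled graphs, so the exceptions are required
  to lie in finitely many isomorphism classes rather than to form a finite set.
\<close>

definition almost_all :: "graph set \<Rightarrow> (graph \<Rightarrow> bool) \<Rightarrow> bool" where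
  "almost_all F P \<longleftrightarrow> (\<exists>S. finite S \<and> (\<forall>G \<in> F. \<not> P G \<longrightarrow> (\<exists>H \<in> S. isomorphic G H)))"

definition forcing :: "nat \<Rightarrow> graph set \<Rightarrow> bool" where
  "forcing k F \<longleftrightarrow> almost_all F (\<lambda>G. \<forall>w. local_positive k G w \<longrightarrow> weight w G > 0)"

definition weak_lower_bound :: "nat \<Rightarrow> graph set \<Rightarrow> real \<Rightarrow> bool" where
  "weak_lower_bound k F C \<longleftrightarrow>
     almost_all F (\<lambda>G. \<forall>w. local_positive k G w \<longrightarrow> real_of_int (weight w G) \<ge> C)"

definition weakly_forcing :: "nat \<Rightarrow> graph set \<Rightarrow> bool" where
  "weakly_forcing k F \<longleftrightarrow> \<not> forcing k F \<and> (\<exists>C. weak_lower_bound k F C)"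

definition weak_const :: "nat \<Rightarrow> graph set \<Rightarrow> real" where
  "weak_const k F = (GREATEST C. weak_lower_bound k F C)"

definition collapses :: "nat \<Rightarrow> graph set \<Rightarrow> bool" where
  "collapses k F \<longleftrightarrow> \<not> forcing k F \<and> \<not> weakly_forcing k F"

definition linear_lower_bound :: "nat \<Rightarrow> graph set \<Rightarrow> real \<Rightarrow> bool" where
  "linear_lower_bound k F c \<longleftrightarrow>
     (\<exists>h :: nat \<Rightarrow> real. h \<in> o(\<lambda>n. real n) \<and>
        (\<forall>G \<in> F. \<forall>w. local_positive k G w \<longrightarrow>
           real_of_int (weight w G) \<ge> c * real (card (edges G)) - h (card (edges G))))"

definition collapse_const :: "nat \<Rightarrow> graph set \<Rightarrow> real" where
  "collapse_const k F = Sup {c. c \<le> 0 \<and> linear_lower_bound k F c}"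

text \<open>The maximum defining \<open>weak_const\<close> is attained, because weights are integers.\<close>

lemma weak_const_is_max:
  assumes "weakly_forcing k F"
  shows "weak_lower_bound k F (weak_const k F)"
    and "\<And>C. weak_lower_bound k F C \<Longrightarrow> C \<le> weak_const k F"
proof -
  define A where "A = {C. weak_lower_bound k F C}"
  have ub: "C \<le> 0" if "C \<in> A" for C
  proof (rule ccontr)
    assume "\<not> C \<le> 0"
    then have "forcing k F"
      using that unfolding A_def weak_lower_bound_def forcing_def almost_all_def mem_Collect_eq
      by (smt (verit) of_int_0_less_iff)
    with assms show False by (simp add: weakly_forcing_def)
  qed
  have ne: "A \<noteq> {}" using assms by (auto simp: A_def weakly_forcing_def)
  have bdd: "bdd_above A" using ub by (meson bdd_aboveI)
  have ceil: "real_of_int \<lceil>C\<rceil> \<in> A" if "C \<in> A" for C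
    using that unfolding A_def weak_lower_bound_def mem_Collect_eq
    by (simp add: ceiling_le_iff)
  define s where "s = Sup A"
  have "real_of_int \<lceil>s\<rceil> - 1 < s" by linarith
  then obtain C where C: "C \<in> A" "real_of_int \<lceil>s\<rceil> - 1 < C"
    using less_cSup_iff[OF ne bdd] unfolding s_def by blast
  have "real_of_int \<lceil>C\<rceil> \<le> s" unfolding s_def by (rule cSup_upper[OF ceil[OF C(1)] bdd])
  moreover have "\<lceil>s\<rceil> \<le> \<lceil>C\<rceil>" using C(2) by (simp add: le_ceiling_iff)
  then have "s \<le> real_of_int \<lceil>C\<rceil>" by (simp add: ceiling_le_iff)
  ultimately have sA: "s \<in> A" using ceil[OF C(1)] by simp
  have up: "C \<le> s" if "C \<in> A" for C using cSup_upper[OF that bdd] by (simp add: s_def)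
  have eq: "weak_const k F = s"
    unfolding weak_const_def by (rule Greatest_equality) (use sA up in \<open>auto simp: A_def\<close>)
  show "weak_lower_bound k F (weak_const k F)" using sA eq by (simp add: A_def)
  show "C \<le> weak_const k F" if "weak_lower_bound k F C" for C
    using up[of C] that eq by (simp add: A_def)
qed

text \<open>The set whose supremum defines \<open>collapse_const\<close> is bounded by 0 and contains -1.\<close>

lemma linear_lower_bound_minus_one: "linear_lower_bound k F (-1)"
proof -
  have "real_of_int (weight w G) \<ge> - real (card (edges G))" if "local_positive k G w" for G w
  proof -
    have "(\<Sum>e\<in>edges G. -1) \<le> weight w G"
      unfolding weight_def
      by (rule sum_mono) (use that in \<open>auto simp: local_positive_def weighing_def\<close>)
    then show ?thesis by simp
  qed
  then show ?thesis unfolding linear_lower_bound_def by (intro exI[of _ "\<lambda>_. 0"]) auto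
qed

end

theory Submission
  imports Defs
begin

text \<open>
  Replacing a cycle edge \<open>uv\<close> by a pendant edge \<open>ux\<close> at a new vertex \<open>x\<close> opens the cycle. Folding
  \<open>x\<close> back onto \<open>v\<close> is a homomorphism that is bijective on edges, so it sends connected subgraphs
  with \<open>k\<close> edges to such subgraphs; hence local positivity, the total weight and the degree bound
  survive, and repeating the step turns any connected graph into a tree with the same number of
  edges and the same weight. Since a number of edges determines finitely many connected graphs,
  all the equivalences follow. For the growth of the weight in the forcing case, a large connected
  graph is cut into two edge-disjoint large connected pieces; the weight is the sum of the
  weights of the pieces, so it exceeds every bound by induction.
\<close>

section \<open>Number of edges and finiteness up to isomorphism\<close>

lemma simple_graph_edgeE:
  assumes "simple_graph G" "e \<in> edges G"
  obtains u v where "e = {u, v}" "u \<in> verts G" "v \<in> verts G" "u \<noteq> v"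
  using assms unfolding simple_graph_def by blast

lemma finite_edges: "simple_graph G \<Longrightarrow> finite (edges G)"
  by (rule finite_subset[of _ "Pow (verts G)"]) (auto simp: simple_graph_def)

lemma card_edges_le:
  assumes "simple_graph G"
  shows "card (edges G) \<le> 2 ^ card (verts G)"
proof -
  have "edges G \<subseteq> Pow (verts G)" "finite (verts G)"
    using assms by (auto simp: simple_graph_def)
  then show ?thesis
    by (metis card_Pow card_mono finite_Pow_iff)
qed

text \<open>Any vertex other than a fixed root is an endpoint of the last edge of a walk from the
  root, and each edge covers two vertices. The crude factor 2 is enough both for finiteness up to
  isomorphism and for the termination of cycle opening.\<close>

lemma card_verts_le:
  assumes "connected_graph G"
  shows "card (verts G) \<le> 2 * card (edges G) + 1"
proof -
  have sg: "simple_graph G" and ne: "verts G \<noteq> {}"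
    and conn: "\<And>u v. u \<in> verts G \<Longrightarrow> v \<in> verts G \<Longrightarrow> (u, v) \<in> (adjacency G)\<^sup>*"
    using assms by (auto simp: connected_graph_def)
  obtain r where r: "r \<in> verts G" using ne by blast
  have "verts G \<subseteq> insert r (\<Union> (edges G))"
  proof
    fix v assume v: "v \<in> verts G"
    show "v \<in> insert r (\<Union> (edges G))"
      using conn[OF r v] by (cases rule: rtranclE) (auto simp: adjacency_def)
  qed
  moreover have two: "card e = 2" if "e \<in> edges G" for e
    using simple_graph_edgeE[OF sg that] by (metis card_2_iff)
  have fin: "finite (\<Union> (edges G))"
    using finite_edges[OF sg] two by (intro finite_Union) (auto intro: card_ge_0_finite)
  ultimately have "card (verts G) \<le> card (insert r (\<Union> (edges G)))"
    by (intro card_mono) auto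
  also have "\<dots> \<le> Suc (card (\<Union> (edges G)))" by (rule card_insert_le_m1) auto
  also have "card (\<Union> (edges G)) \<le> (\<Sum>e\<in>edges G. card e)"
    using card_UN_le[OF finite_edges[OF sg], of "\<lambda>e. e"] by simp
  also have "\<dots> = 2 * card (edges G)" using two by simp
  finally show ?thesis by simp
qed

text \<open>Few edges force few vertices by \<open>card_verts_le\<close>, so such a graph can be
  relabelled on an initial segment of the naturals. The representatives are all pairs over that
  segment, including ones that are not graphs.\<close>

lemma finite_connected_graphs_upto_iso:
  "\<exists>S. finite S \<and> (\<forall>G. connected_graph G \<and> card (edges G) < m \<longrightarrow> (\<exists>H\<in>S. isomorphic G H))"
proof (intro exI conjI allI impI)
  let ?V = "Pow {..<2 * m + 1 :: nat}"
  let ?S = "?V \<times> Pow ?V"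
  show "finite ?S" by simp
  fix G assume G: "connected_graph G \<and> card (edges G) < m"
  then have sg: "simple_graph G" and fin: "finite (verts G)"
    by (auto simp: connected_graph_def simple_graph_def)
  have le: "card (verts G) \<le> 2 * m + 1" using card_verts_le[of G] G by linarith
  obtain \<phi> where \<phi>: "bij_betw \<phi> (verts G) {0..<card (verts G)}"
    using ex_bij_betw_finite_nat[OF fin] by blast
  have inj: "inj_on \<phi> (verts G)" using \<phi> by (simp add: bij_betw_def)
  have img: "\<phi> ` verts G \<subseteq> {..<2 * m + 1}"
    using \<phi> le by (auto simp: bij_betw_def)
  let ?H = "(\<phi> ` verts G, (`) \<phi> ` edges G)"
  have sub: "e \<subseteq> verts G" if "e \<in> edges G" for e
    using simple_graph_edgeE[OF sg that] by blast
  have "isomorphic G ?H"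
    unfolding isomorphic_def
  proof (intro exI conjI ballI)
    show "bij_betw \<phi> (verts G) (verts ?H)" using inj by (simp add: bij_betw_def)
    fix u v assume uv: "u \<in> verts G" "v \<in> verts G"
    show "{u, v} \<in> edges G \<longleftrightarrow> {\<phi> u, \<phi> v} \<in> edges ?H"
    proof
      assume "{u, v} \<in> edges G"
      then show "{\<phi> u, \<phi> v} \<in> edges ?H" by (auto intro!: image_eqI[of _ _ "{u, v}"])
    next
      assume "{\<phi> u, \<phi> v} \<in> edges ?H"
      then obtain e where e: "e \<in> edges G" "\<phi> ` e = \<phi> ` {u, v}" by auto
      then have "e = {u, v}"
        using inj_on_image_eq_iff[OF inj sub[OF e(1)], of "{u, v}"] uv by simp
      with e(1) show "{u, v} \<in> edges G" by simp
    qed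
  qed
  moreover have "?H \<in> ?S" using img sub by auto
  ultimately show "\<exists>H\<in>?S. isomorphic G H" by blast
qed

text \<open>Removes isomorphism from all later arguments. The threshold counts edges rather than
  vertices because opening a cycle keeps the former and increases the latter.\<close>

lemma almost_all_iff_large:
  assumes "F \<subseteq> connected_graphs"
  shows "almost_all F P \<longleftrightarrow> (\<exists>m. \<forall>G\<in>F. m \<le> card (edges G) \<longrightarrow> P G)"
proof
  assume "almost_all F P"
  then obtain S where S: "finite S" "\<And>G. G \<in> F \<Longrightarrow> \<not> P G \<Longrightarrow> \<exists>H\<in>S. isomorphic G H"
    unfolding almost_all_def by blast
  \<comment> \<open>The sum dominates each single bound \<open>2 ^ card (verts H)\<close> and also
    makes sense for empty \<open>S\<close>; \<open>Suc\<close> puts the threshold strictly above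
    it.\<close>
  let ?m = "Suc (\<Sum>H\<in>S. 2 ^ card (verts H))"
  have "P G" if G: "G \<in> F" "?m \<le> card (edges G)" for G
  proof (rule ccontr)
    assume "\<not> P G"
    then obtain H where H: "H \<in> S" "isomorphic G H" using S(2) G(1) by blast
    then have "card (verts G) = card (verts H)"
      unfolding isomorphic_def using bij_betw_same_card by blast
    moreover have "simple_graph G"
      using assms G(1) by (auto simp: connected_graphs_def connected_graph_def)
    ultimately have "card (edges G) \<le> 2 ^ card (verts H)" using card_edges_le by metis
    also have "\<dots> \<le> (\<Sum>H\<in>S. 2 ^ card (verts H))" by (rule member_le_sum[OF H(1) _ S(1)]) simp
    finally show False using G(2) by simp
  qed
  then show "\<exists>m. \<forall>G\<in>F. m \<le> card (edges G) \<longrightarrow> P G" by blast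
next
  assume "\<exists>m. \<forall>G\<in>F. m \<le> card (edges G) \<longrightarrow> P G"
  then obtain m where m: "\<And>G. G \<in> F \<Longrightarrow> m \<le> card (edges G) \<Longrightarrow> P G" by blast
  obtain S where S: "finite S"
      "\<And>G. connected_graph G \<Longrightarrow> card (edges G) < m \<Longrightarrow> \<exists>H\<in>S. isomorphic G H"
    using finite_connected_graphs_upto_iso[of m] by metis
  have "\<exists>H\<in>S. isomorphic G H" if "G \<in> F" "\<not> P G" for G
  proof (rule S(2))
    show "connected_graph G" using that assms by (auto simp: connected_graphs_def)
    show "card (edges G) < m" using m[of G] that by (meson not_le)
  qed
  with S(1) show "almost_all F P" unfolding almost_all_def by blast
qed

section \<open>Opening cycles\<close>

lemma vertex_degree_le_max_degree:
  "simple_graph G \<Longrightarrow> v \<in> verts G \<Longrightarrow> vertex_degree G v \<le> max_degree G"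
  unfolding max_degree_def simple_graph_def by (intro Max_ge) auto

lemma max_degree_leI:
  assumes "connected_graph G" "\<And>v. v \<in> verts G \<Longrightarrow> vertex_degree G v \<le> D"
  shows "max_degree G \<le> D"
  using assms unfolding max_degree_def connected_graph_def simple_graph_def by (subst Max_le_iff) auto

section \<open>Homomorphisms that are injective on edges\<close>

lemma connected_graph_image:
  assumes conn: "connected_graph H"
    and nd: "\<And>u v. {u, v} \<in> edges H \<Longrightarrow> \<phi> u \<noteq> \<phi> v"
  shows "connected_graph (\<phi> ` verts H, (`) \<phi> ` edges H)" (is "connected_graph ?I")
proof -
  have sg: "simple_graph H" using conn by (simp add: connected_graph_def)
  have edge: "\<exists>u v. \<phi> ` e = {u, v} \<and> u \<in> \<phi> ` verts H \<and> v \<in> \<phi> ` verts H \<and> u \<noteq> v"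
    if e: "e \<in> edges H" for e
  proof -
    obtain u v where uv: "e = {u, v}" "u \<in> verts H" "v \<in> verts H"
      using simple_graph_edgeE[OF sg e] by blast
    then show ?thesis
      using nd[of u v] e by (intro exI[of _ "\<phi> u"] exI[of _ "\<phi> v"]) auto
  qed
  have "simple_graph ?I"
    using sg edge unfolding simple_graph_def by auto
  moreover have "(\<phi> u, \<phi> v) \<in> (adjacency ?I)\<^sup>*" if "(u, v) \<in> (adjacency H)\<^sup>*" for u v
    using that
  proof induction
    case (step y z)
    have "{y, z} \<in> edges H" using step(2) by (simp add: adjacency_def)
    then have "\<phi> ` {y, z} \<in> (`) \<phi> ` edges H" by (rule imageI)
    then have "(\<phi> y, \<phi> z) \<in> adjacency ?I" by (simp add: adjacency_def)
    with step.IH show ?case by (rule rtrancl_into_rtrancl)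
  qed simp
  ultimately show ?thesis using conn by (auto simp: connected_graph_def)
qed

text \<open>The map may identify vertices but is a bijection on edges. Edges at \<open>v\<close>
  therefore inject into edges at \<open>\<phi> v\<close>, and a connected subgraph with
  \<open>k\<close> edges has a connected image with \<open>k\<close> edges and the same
  weight.\<close>

lemma edge_injective_hom_pullback:
  assumes conn: "connected_graph G'" and sg: "simple_graph G"
    and V: "\<phi> ` verts G' \<subseteq> verts G" and E: "(`) \<phi> ` edges G' = edges G"
    and inj: "inj_on ((`) \<phi>) (edges G')"
  shows "card (edges G') = card (edges G)"
    and "max_degree G' \<le> max_degree G"
    and "local_positive k G w \<Longrightarrow> local_positive k G' (\<lambda>e. w (\<phi> ` e))"
    and "weight (\<lambda>e. w (\<phi> ` e)) G' = weight w G"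
proof -
  have sg': "simple_graph G'" using conn by (simp add: connected_graph_def)
  show "card (edges G') = card (edges G)" using card_image[OF inj] E by simp
  show "max_degree G' \<le> max_degree G"
  proof (rule max_degree_leI[OF conn])
    fix v assume v: "v \<in> verts G'"
    have "vertex_degree G' v = card ((`) \<phi> ` {e \<in> edges G'. v \<in> e})"
      unfolding vertex_degree_def
      by (rule card_image[symmetric]) (rule inj_on_subset[OF inj], auto)
    also have "\<dots> \<le> vertex_degree G (\<phi> v)"
      unfolding vertex_degree_def using E finite_edges[OF sg] by (intro card_mono) auto
    also have "\<dots> \<le> max_degree G" using vertex_degree_le_max_degree[OF sg] V v by blast
    finally show "vertex_degree G' v \<le> max_degree G" .
  qed
  have weight_image: "weight (\<lambda>e. w (\<phi> ` e)) H = weight w (\<phi> ` verts H, (`) \<phi> ` edges H)"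
    if "edges H \<subseteq> edges G'" for H
    unfolding weight_def by (simp add: sum.reindex[OF inj_on_subset[OF inj that]] comp_def)
  show "weight (\<lambda>e. w (\<phi> ` e)) G' = weight w G"
    using weight_image[of G'] E by (simp add: weight_def)
  assume lp: "local_positive k G w"
  show "local_positive k G' (\<lambda>e. w (\<phi> ` e))"
    unfolding local_positive_def
  proof (intro conjI allI impI)
    show "weighing G' (\<lambda>e. w (\<phi> ` e))"
      using lp E unfolding local_positive_def weighing_def by auto
    fix H assume H: "subgraph H G' \<and> connected_graph H \<and> card (edges H) = k"
    let ?I = "(\<phi> ` verts H, (`) \<phi> ` edges H)"
    have sub: "edges H \<subseteq> edges G'" "verts H \<subseteq> verts G'"
      using H by (auto simp: subgraph_def)
    \<comment> \<open>An edge is mapped to an edge of the simple graph \<open>G\<close>, which has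
      two distinct endpoints.\<close>
    have "\<phi> u \<noteq> \<phi> v" if "{u, v} \<in> edges H" for u v
    proof -
      have "\<phi> ` {u, v} \<in> edges G" using that sub E by blast
      then show ?thesis by (rule simple_graph_edgeE[OF sg]) auto
    qed
    then have I: "connected_graph ?I" using H connected_graph_image by blast
    moreover have "subgraph ?I G"
      unfolding subgraph_def
    proof (intro conjI)
      show "simple_graph ?I" using I by (simp add: connected_graph_def)
      show "verts ?I \<subseteq> verts G" using V sub by auto
      show "edges ?I \<subseteq> edges G" using E sub by auto
    qed
    moreover have "card (edges ?I) = k"
      using H card_image[OF inj_on_subset[OF inj sub(1)]] by simp
    ultimately have "weight w ?I > 0" using lp by (auto simp: local_positive_def)
    then show "weight (\<lambda>e. w (\<phi> ` e)) H > 0" using weight_image[OF sub(1)] by simp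
  qed
qed

section \<open>Reachability and the opening of a single cycle edge\<close>

lemma adjacency_rtrancl_mono:
  "edges H \<subseteq> edges G \<Longrightarrow> (u, v) \<in> (adjacency H)\<^sup>* \<Longrightarrow> (u, v) \<in> (adjacency G)\<^sup>*"
  by (rule rtrancl_mono[THEN subsetD, of "adjacency H"]) (auto simp: adjacency_def)

lemma adjacency_rtrancl_sym: "(u, v) \<in> (adjacency G)\<^sup>* \<Longrightarrow> (v, u) \<in> (adjacency G)\<^sup>*"
  by (rule symD[OF sym_rtrancl]) (auto simp: sym_def adjacency_def insert_commute)

lemma connected_graph_if_reachable:
  assumes "simple_graph G" "r \<in> verts G" "\<And>v. v \<in> verts G \<Longrightarrow> (r, v) \<in> (adjacency G)\<^sup>*"
  shows "connected_graph G"
  unfolding connected_graph_def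
proof (intro conjI ballI)
  fix u v assume "u \<in> verts G" "v \<in> verts G"
  then show "(u, v) \<in> (adjacency G)\<^sup>*"
    using assms(3) by (metis adjacency_rtrancl_sym rtrancl_trans)
qed (use assms in auto)

text \<open>The bypass runs around the cycle the other way, from index 1 up to the last index and
  then back to 0. The vertex set \<open>V\<close> is arbitrary because \<open>adjacency\<close>
  reads only edges.\<close>

lemma cycle_edge_bypass:
  assumes "is_cycle G vs"
  shows "(vs ! 1, vs ! 0) \<in> (adjacency (V, edges G - {{vs ! 0, vs ! 1}}))\<^sup>*"
proof -
  let ?n = "length vs"
  let ?A = "adjacency (V, edges G - {{vs ! 0, vs ! 1}})"
  have n: "?n \<ge> 3" and d: "distinct vs"
    and ed: "\<And>i. i < ?n \<Longrightarrow> {vs ! i, vs ! (Suc i mod ?n)} \<in> edges G"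
    using assms by (auto simp: is_cycle_def)
  have neq: "vs ! i \<noteq> vs ! j" if "i < ?n" "j < ?n" "i \<noteq> j" for i j
    using d that by (simp add: nth_eq_iff_index_eq)
  have path: "Suc i < ?n \<Longrightarrow> (vs ! 1, vs ! Suc i) \<in> ?A\<^sup>*" for i
  proof (induction i)
    case (Suc i)
    have "{vs ! Suc i, vs ! Suc (Suc i)} \<in> edges G" using ed[of "Suc i"] Suc.prems by simp
    moreover have "0 < ?n" using n by linarith
    then have "vs ! Suc (Suc i) \<noteq> vs ! 0" by (intro neq Suc.prems) simp_all
    moreover have "vs ! Suc (Suc i) \<noteq> vs ! 1" using Suc.prems by (intro neq) simp_all
    ultimately have "(vs ! Suc i, vs ! Suc (Suc i)) \<in> ?A"
      by (auto simp: adjacency_def doubleton_eq_iff)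
    then show ?case using Suc by (meson Suc_lessD rtrancl_into_rtrancl)
  qed simp
  \<comment> \<open>\<open>path\<close> at \<open>i\<close> ends at index \<open>Suc i\<close>, so
    \<open>?n - 2\<close> reaches the last vertex. The closing edge follows separately; it differs
    from the removed edge since length at least 3 gives \<open>?n - 1 \<noteq> 1\<close>.\<close>
  have "(vs ! 1, vs ! (?n - 1)) \<in> ?A\<^sup>*" using path[of "?n - 2"] n
    by (simp add: Suc_diff_Suc numeral_2_eq_2)
  moreover have "(vs ! (?n - 1), vs ! 0) \<in> ?A"
  proof -
    have lt: "?n - 1 < ?n" "0 < ?n" "1 < ?n" "?n - 1 \<noteq> 0" "?n - 1 \<noteq> 1" "Suc (?n - 1) = ?n"
      using n by linarith+
    have "{vs ! (?n - 1), vs ! 0} \<in> edges G" using ed[OF lt(1)] unfolding lt(6) mod_self .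
    moreover have "vs ! (?n - 1) \<noteq> vs ! 0" "vs ! (?n - 1) \<noteq> vs ! 1"
      by (rule neq[OF lt(1,2,4)], rule neq[OF lt(1,3,5)])
    ultimately show ?thesis by (auto simp: adjacency_def doubleton_eq_iff)
  qed
  ultimately show ?thesis by (rule rtrancl_into_rtrancl)
qed

text \<open>Removing an edge of a cycle keeps the old vertices connected, and the new vertex
  \<open>x\<close> hangs at \<open>u\<close>. The count of vertices in the conclusion is the measure
  of progress for the iteration.\<close>

lemma open_cycle:
  assumes conn: "connected_graph G" and cyc: "is_cycle G vs"
  obtains G' \<phi> where "connected_graph G'" "\<phi> ` verts G' \<subseteq> verts G"
    "(`) \<phi> ` edges G' = edges G" "inj_on ((`) \<phi>) (edges G')"
    "card (verts G') = Suc (card (verts G))"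
proof -
  have sg: "simple_graph G" and ne: "verts G \<noteq> {}" and fin: "finite (verts G)"
    using conn by (auto simp: connected_graph_def simple_graph_def)
  define u v where "u = vs ! 0" and "v = vs ! 1"
  have len: "length vs \<ge> 3" using cyc by (simp add: is_cycle_def)
  have "{vs ! 0, vs ! (Suc 0 mod length vs)} \<in> edges G"
    using cyc len unfolding is_cycle_def by (metis gr0I not_numeral_le_zero)
  then have uvE: "{u, v} \<in> edges G" using len by (simp add: u_def v_def)
  have uv: "u \<in> verts G" "v \<in> verts G" "u \<noteq> v"
    using simple_graph_edgeE[OF sg uvE] by (auto simp: doubleton_eq_iff)
  obtain x where x: "x \<notin> verts G" using ex_new_if_finite[OF _ fin] by auto
  define G0 where "G0 = (verts G, edges G - {{u, v}})"
  define G' where "G' = (insert x (verts G), insert {u, x} (edges G - {{u, v}}))"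
  define \<phi> where "\<phi> = (\<lambda>y. if y = x then v else y)"
  have sub: "e \<subseteq> verts G" if "e \<in> edges G" for e
    using simple_graph_edgeE[OF sg that] by blast
  have \<phi>id: "\<phi> ` e = e" if "e \<in> edges G" for e
    using sub[OF that] x by (auto simp: \<phi>_def image_iff)
  have \<phi>ux: "\<phi> ` {u, x} = {u, v}" using uv x by (auto simp: \<phi>_def)
  have byp: "(v, u) \<in> (adjacency G0)\<^sup>*"
    using cycle_edge_bypass[OF cyc] by (simp add: G0_def u_def v_def)
  have step: "(a, b) \<in> (adjacency G0)\<^sup>*" if "(a, b) \<in> adjacency G" for a b
  proof (cases "{a, b} = {u, v}")
    case True
    then show ?thesis using byp adjacency_rtrancl_sym[OF byp] by (auto simp: doubleton_eq_iff)
  next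
    case False
    then show ?thesis using that by (auto simp: adjacency_def G0_def)
  qed
  have G0: "(a, b) \<in> (adjacency G')\<^sup>*" if "a \<in> verts G" "b \<in> verts G" for a b
  proof -
    have "(a, b) \<in> (adjacency G)\<^sup>*" using conn that by (auto simp: connected_graph_def)
    then have "(a, b) \<in> (adjacency G0)\<^sup>*"
      by (rule rtrancl_subset_rtrancl[THEN subsetD, rotated]) (use step in auto)
    then show ?thesis by (rule adjacency_rtrancl_mono[rotated]) (auto simp: G0_def G'_def)
  qed
  have ux: "(u, x) \<in> (adjacency G')\<^sup>*" by (rule r_into_rtrancl) (simp add: adjacency_def G'_def)
  have from_u: "(u, a) \<in> (adjacency G')\<^sup>*" if "a \<in> verts G'" for a
    using that ux G0[OF uv(1)] by (auto simp: G'_def)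
  have "simple_graph G'"
    using sg uv x unfolding simple_graph_def G'_def by auto
  moreover have "u \<in> verts G'" using uv by (simp add: G'_def)
  ultimately have "connected_graph G'" using connected_graph_if_reachable from_u by blast
  moreover have "\<phi> ` verts G' \<subseteq> verts G" using uv by (auto simp: \<phi>_def G'_def)
  moreover have "(`) \<phi> ` edges G' = edges G"
  proof -
    have "(`) \<phi> ` (edges G - {{u, v}}) = edges G - {{u, v}}" using \<phi>id by (force simp: image_iff)
    then show ?thesis using uvE \<phi>ux by (auto simp: G'_def)
  qed
  \<comment> \<open>\<open>\<phi>\<close> fixes every remaining old edge and sends the pendant edge
    to \<open>{u, v}\<close>, which is no longer among them.\<close>
  moreover have "inj_on ((`) \<phi>) (edges G')"
  proof -
    have "inj_on ((`) \<phi>) (edges G - {{u, v}})" using \<phi>id by (auto simp: inj_on_def)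
    then show ?thesis using \<phi>id \<phi>ux by (auto simp: G'_def)
  qed
  moreover have "card (verts G') = Suc (card (verts G))" using fin x by (simp add: G'_def)
  ultimately show ?thesis using that by blast
qed

text \<open>Each opening adds a vertex and keeps the number of edges, and
  \<open>card_verts_le\<close> caps the number of vertices, so the process stops at a graph without
  cycles.\<close>

lemma unfold_to_tree:
  assumes "connected_graph G" "local_positive k G w"
  shows "\<exists>T w'. is_tree T \<and> max_degree T \<le> max_degree G \<and> card (edges T) = card (edges G) \<and>
           local_positive k T w' \<and> weight w' T = weight w G"
  using assms
proof (induction "2 * card (edges G) + 1 - card (verts G)" arbitrary: G w rule: less_induct)
  case less
  show ?case
  proof (cases "is_tree G")
    case True
    then show ?thesis using less.prems by blast
  next
    case False
    then obtain vs where "is_cycle G vs" using less.prems by (auto simp: is_tree_def)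
    then obtain G' \<phi> where G': "connected_graph G'" "\<phi> ` verts G' \<subseteq> verts G"
      "(`) \<phi> ` edges G' = edges G" "inj_on ((`) \<phi>) (edges G')"
      "card (verts G') = Suc (card (verts G))"
      using open_cycle[OF less.prems(1)] by metis
    have "simple_graph G" using less.prems by (simp add: connected_graph_def)
    note hom = edge_injective_hom_pullback[OF G'(1) this G'(2-4)]
    \<comment> \<open>Applying \<open>card_verts_le\<close> to \<open>G'\<close> excludes truncation
      to 0 of the difference for \<open>G\<close>, so the decrease is strict.\<close>
    have "2 * card (edges G') + 1 - card (verts G') < 2 * card (edges G) + 1 - card (verts G)"
      using card_verts_le[OF G'(1)] hom(1) G'(5) by linarith
    from less.hyps[OF this G'(1) hom(3)[OF less.prems(2)]] show ?thesis
      using hom(1,2,4) by (metis le_trans)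
  qed
qed

section \<open>Cutting a connected graph into large connected pieces\<close>

definition edge_reach :: "nat set set \<Rightarrow> nat \<Rightarrow> nat set" where
  "edge_reach A v = {y. (v, y) \<in> (adjacency ({}, A))\<^sup>*}"

text \<open>The edges of \<open>A\<close> together with the root \<open>v\<close> form a connected
  graph. Empty \<open>A\<close> is allowed and stands for the single vertex
  \<open>v\<close>.\<close>

definition connected_from :: "nat \<Rightarrow> nat set set \<Rightarrow> bool" where
  "connected_from v A \<longleftrightarrow> (\<forall>e\<in>A. e \<subseteq> edge_reach A v)"

lemma edge_reach_refl [simp]: "v \<in> edge_reach A v"
  by (simp add: edge_reach_def)

lemma edge_reach_step: "y \<in> edge_reach A v \<Longrightarrow> {y, z} \<in> A \<Longrightarrow> z \<in> edge_reach A v"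
  by (auto simp: edge_reach_def adjacency_def intro: rtrancl_into_rtrancl)

lemma edge_reach_induct [consumes 1, case_names refl step]:
  assumes "y \<in> edge_reach A v" "P v"
    "\<And>y z. y \<in> edge_reach A v \<Longrightarrow> {y, z} \<in> A \<Longrightarrow> P y \<Longrightarrow> P z"
  shows "P y"
proof -
  have "(v, y) \<in> (adjacency ({}, A))\<^sup>*" using assms(1) by (simp add: edge_reach_def)
  then show ?thesis
    by induction (use assms(2,3) in \<open>auto simp: edge_reach_def adjacency_def\<close>)
qed

lemma edge_reach_trans: "y \<in> edge_reach A v \<Longrightarrow> z \<in> edge_reach A y \<Longrightarrow> z \<in> edge_reach A v"
  by (auto simp: edge_reach_def)

lemma edge_reach_mono: "A \<subseteq> B \<Longrightarrow> edge_reach A v \<subseteq> edge_reach B v"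
  using adjacency_rtrancl_mono[of "({}, A)" "({}, B)"] by (auto simp: edge_reach_def)

lemma connected_from_Un: "connected_from v A \<Longrightarrow> connected_from v B \<Longrightarrow> connected_from v (A \<union> B)"
  unfolding connected_from_def
  using edge_reach_mono[of A "A \<union> B" v] edge_reach_mono[of B "A \<union> B" v] by blast

lemma connected_from_insert:
  assumes "connected_from y A"
  shows "connected_from v (insert {v, y} A)"
proof -
  have "y \<in> edge_reach (insert {v, y} A) v" by (rule edge_reach_step[of v]) auto
  then show ?thesis
    using assms edge_reach_mono[of A "insert {v, y} A" y] edge_reach_trans
    unfolding connected_from_def by fastforce
qed

text \<open>A walk from \<open>v\<close> never leaves the component of \<open>v\<close>, so
  discarding the edges outside it loses no reachability.\<close>

lemma connected_from_reach:
  "connected_from v {f \<in> A. f \<subseteq> edge_reach A v}" (is "connected_from v ?A")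
proof -
  have "z \<in> edge_reach ?A v" if "z \<in> edge_reach A v" for z
    using that
  proof (induction rule: edge_reach_induct)
    case (step y z)
    then have "{y, z} \<in> ?A" by (auto intro: edge_reach_step)
    with step show ?case by (auto intro: edge_reach_step)
  qed simp
  then show ?thesis by (auto simp: connected_from_def)
qed

text \<open>Without the edge \<open>{v, y}\<close>, whatever is cut off from \<open>v\<close> must
  hang at \<open>y\<close>.\<close>

lemma connected_from_rest:
  assumes A: "connected_from v A"
    and two: "\<And>f. f \<in> A \<Longrightarrow> \<exists>a b. f = {a, b}"
    and A0: "A0 = A - {{v, y}}"
  shows "connected_from y {f \<in> A0. \<not> f \<subseteq> edge_reach A0 v}" (is "connected_from y ?Y")
proof -
  have cover: "z \<in> edge_reach A0 v \<or> z \<in> edge_reach ?Y y" if "z \<in> edge_reach A v" for z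
    using that
  proof (induction rule: edge_reach_induct)
    case (step a b)
    show ?case
    proof (cases "{a, b} = {v, y}")
      case True
      then show ?thesis by (auto simp: doubleton_eq_iff)
    next
      case False
      then have "{a, b} \<in> A0" using step A0 by auto
      then show ?thesis using step edge_reach_step[of a A0 v b] edge_reach_step[of a ?Y y b] by auto
    qed
  qed simp
  have "f \<subseteq> edge_reach ?Y y" if f: "f \<in> ?Y" for f
  proof -
    have fA: "f \<in> A" "f \<in> A0" using f A0 by auto
    then obtain a b where ab: "f = {a, b}" using two by blast
    \<comment> \<open>An edge of \<open>A0\<close> with one endpoint in the component of
      \<open>v\<close> lies wholly inside it, so both endpoints of an edge of \<open>?Y\<close> are
      outside.\<close>
    have "a \<in> edge_reach A0 v \<longleftrightarrow> b \<in> edge_reach A0 v"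
      using edge_reach_step[of a A0 v b] edge_reach_step[of b A0 v a] fA ab
      by (auto simp: insert_commute)
    then have "a \<notin> edge_reach A0 v" "b \<notin> edge_reach A0 v" using f ab by auto
    moreover have "a \<in> edge_reach A v" "b \<in> edge_reach A v"
      using A fA(1) ab by (auto simp: connected_from_def)
    ultimately show ?thesis using cover ab by auto
  qed
  then show ?thesis by (auto simp: connected_from_def)
qed

lemma connected_from_root_edge:
  assumes "connected_from v A" "A \<noteq> {}" and two: "\<And>f. f \<in> A \<Longrightarrow> \<exists>a b. f = {a, b}"
  obtains y where "{v, y} \<in> A"
proof -
  obtain f where f: "f \<in> A" using assms by blast
  then obtain a b where ab: "f = {a, b}" using two by blast
  have "a \<in> edge_reach A v" using assms f ab by (auto simp: connected_from_def)
  then have "(v, a) \<in> (adjacency ({}, A))\<^sup>*" by (simp add: edge_reach_def)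
  then show ?thesis
    using that f ab by (cases rule: converse_rtranclE) (auto simp: adjacency_def)
qed

text \<open>\<open>A\<close> and \<open>B\<close> share a root. While \<open>A\<close> has more than
  \<open>2 * M\<close> edges, deleting a root edge leaves \<open>X\<close> at \<open>v\<close> and
  \<open>Y\<close> at \<open>y\<close> with at least \<open>2 * M\<close> edges together. One of
  them with at least \<open>M\<close> edges becomes the new \<open>A\<close>, and everything else
  joins \<open>B\<close>.\<close>

lemma split_connected_from:
  assumes "connected_from v A" "connected_from v B" "finite A" "A \<inter> B = {}" "v \<in> V"
    and "\<And>f. f \<in> A \<Longrightarrow> \<exists>a b. f = {a, b}" "\<And>f. f \<in> A \<Longrightarrow> f \<subseteq> V" "M \<le> card A" "1 \<le> M"
  shows "\<exists>v' A' B'. v' \<in> V \<and> connected_from v' A' \<and> connected_from v' B' \<and> A' \<inter> B' = {} \<and>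
           A' \<union> B' = A \<union> B \<and> M \<le> card A' \<and> card A' \<le> 2 * M"
  using assms
proof (induction "card A" arbitrary: v A B rule: less_induct)
  case less
  show ?case
  proof (cases "card A \<le> 2 * M")
    case True
    then show ?thesis using less.prems by blast
  next
    case False
    have "A \<noteq> {}" using False by auto
    then obtain y where y: "{v, y} \<in> A"
      using connected_from_root_edge[OF less.prems(1)] less.prems(6) by metis
    define A0 where "A0 = A - {{v, y}}"
    define X where "X = {f \<in> A0. f \<subseteq> edge_reach A0 v}"
    define Y where "Y = {f \<in> A0. \<not> f \<subseteq> edge_reach A0 v}"
    have X: "connected_from v X" unfolding X_def by (rule connected_from_reach)
    have Y: "connected_from y Y"
      unfolding Y_def by (rule connected_from_rest[OF less.prems(1,6) A0_def])
    have fin: "finite X" "finite Y" using less.prems(3) by (auto simp: X_def Y_def A0_def)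
    have part: "A0 = X \<union> Y" "X \<inter> Y = {}" by (auto simp: X_def Y_def)
    have A: "A = insert {v, y} (X \<union> Y)" "{v, y} \<notin> X \<union> Y"
      using y part(1) by (auto simp: A0_def)
    have card: "card A = Suc (card X + card Y)"
      using A fin part(2) by (simp add: card_Un_disjoint)
    have yV: "y \<in> V" using less.prems(7) y by blast
    show ?thesis
    proof (cases "M \<le> card X")
      case True
      \<comment> \<open>The root stays at \<open>v\<close>; the deleted edge ties \<open>Y\<close>
        to it.\<close>
      let ?B = "insert {v, y} Y \<union> B"
      have "\<exists>v' A' B'. v' \<in> V \<and> connected_from v' A' \<and> connected_from v' B' \<and> A' \<inter> B' = {} \<and>
              A' \<union> B' = X \<union> ?B \<and> M \<le> card A' \<and> card A' \<le> 2 * M"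
      proof (rule less.hyps)
        show "connected_from v ?B"
          by (intro connected_from_Un connected_from_insert Y less.prems)
        show "X \<inter> ?B = {}" using A part less.prems(4) by auto
      qed (use card X fin True less.prems A in auto)
      moreover have "X \<union> ?B = A \<union> B" using A by auto
      ultimately show ?thesis by simp
    next
      case False
      \<comment> \<open>The root moves to \<open>y\<close>. The edge is written from
        \<open>y\<close> so that \<open>connected_from_insert\<close> applies with the new
        root.\<close>
      let ?B = "insert {y, v} (X \<union> B)"
      have "\<exists>v' A' B'. v' \<in> V \<and> connected_from v' A' \<and> connected_from v' B' \<and> A' \<inter> B' = {} \<and>
              A' \<union> B' = Y \<union> ?B \<and> M \<le> card A' \<and> card A' \<le> 2 * M"
      proof (rule less.hyps)
        show "connected_from y ?B"
          by (intro connected_from_Un connected_from_insert X less.prems)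
        show "Y \<inter> ?B = {}" using A part less.prems(4) by (auto simp: insert_commute)
        show "M \<le> card Y" using False \<open>\<not> card A \<le> 2 * M\<close> card by linarith
      qed (use card Y yV fin less.prems A in auto)
      moreover have "Y \<union> ?B = A \<union> B" using A by (auto simp: insert_commute)
      ultimately show ?thesis by simp
    qed
  qed
qed

lemma connected_graph_of_connected_from:
  assumes sg: "simple_graph G" and v: "v \<in> verts G" and A: "A \<subseteq> edges G" "connected_from v A"
  shows "connected_graph (insert v (\<Union>A), A)" "subgraph (insert v (\<Union>A), A) G"
proof -
  let ?H = "(insert v (\<Union>A), A)"
  have fv: "finite (verts G)" using sg by (simp add: simple_graph_def)
  have sub: "e \<subseteq> verts G" if "e \<in> A" for e
    using simple_graph_edgeE[OF sg, of e] A that by blast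
  have V: "insert v (\<Union>A) \<subseteq> verts G" using sub v by blast
  have "A \<subseteq> {{a, b} |a b. a \<in> verts ?H \<and> b \<in> verts ?H \<and> a \<noteq> b}"
  proof
    fix e assume e: "e \<in> A"
    then obtain a b where "e = {a, b}" "a \<noteq> b" using simple_graph_edgeE[OF sg, of e] A by blast
    moreover have "a \<in> verts ?H" "b \<in> verts ?H" using e \<open>e = {a, b}\<close> by auto
    ultimately show "e \<in> {{a, b} |a b. a \<in> verts ?H \<and> b \<in> verts ?H \<and> a \<noteq> b}"
      by blast
  qed
  then have sgH: "simple_graph ?H"
    using finite_subset[OF V fv] by (simp add: simple_graph_def)
  then show "subgraph ?H G" using V A by (simp add: subgraph_def)
  have adj: "adjacency ({}, A) = adjacency ?H" by (simp add: adjacency_def)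
  have "(v, a) \<in> (adjacency ?H)\<^sup>*" if "a \<in> verts ?H" for a
    using that A(2) unfolding connected_from_def edge_reach_def adj by auto
  then show "connected_graph ?H" by (intro connected_graph_if_reachable[OF sgH, of v]) auto
qed

text \<open>Splitting starts from all edges and an empty second set. The first piece ends with at
  most \<open>2 * M\<close> of at least \<open>3 * M\<close> edges, which leaves at least
  \<open>M\<close> for the other.\<close>

lemma split_connected_graph:
  assumes conn: "connected_graph G" and m: "3 * M \<le> card (edges G)" and M: "1 \<le> M"
  obtains H1 H2 where "connected_graph H1" "connected_graph H2" "subgraph H1 G" "subgraph H2 G"
    "edges H1 \<inter> edges H2 = {}" "edges H1 \<union> edges H2 = edges G"
    "M \<le> card (edges H1)" "M \<le> card (edges H2)"
proof -
  have sg: "simple_graph G" using conn by (simp add: connected_graph_def)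
  obtain v where v: "v \<in> verts G" using conn by (auto simp: connected_graph_def)
  have adj: "adjacency ({}, edges G) = adjacency G" by (simp add: adjacency_def)
  have "connected_from v (edges G)"
    unfolding connected_from_def edge_reach_def adj
    using conn v by (auto simp: connected_graph_def elim!: simple_graph_edgeE)
  moreover have "connected_from v {}" by (simp add: connected_from_def)
  moreover have "\<exists>a b. f = {a, b}" "f \<subseteq> verts G" if "f \<in> edges G" for f
    using simple_graph_edgeE[OF sg that] by blast+
  ultimately have "\<exists>v' A' B'. v' \<in> verts G \<and> connected_from v' A' \<and> connected_from v' B' \<and>
      A' \<inter> B' = {} \<and> A' \<union> B' = edges G \<union> {} \<and> M \<le> card A' \<and> card A' \<le> 2 * M"
    using v m M finite_edges[OF sg] by (intro split_connected_from) auto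
  then obtain r A B where r: "r \<in> verts G" and A: "connected_from r A" and B: "connected_from r B"
    and AB: "A \<inter> B = {}" "A \<union> B = edges G" and cA: "M \<le> card A" "card A \<le> 2 * M"
    by auto
  have sub: "A \<subseteq> edges G" "B \<subseteq> edges G" using AB by auto
  have fin: "finite A" "finite B" using sub finite_edges[OF sg] finite_subset by auto
  have "card (edges G) = card A + card B" using card_Un_disjoint[OF fin AB(1)] AB(2) by simp
  then have cB: "M \<le> card B" using cA m by linarith
  show ?thesis
    by (rule that[of "(insert r (\<Union>A), A)" "(insert r (\<Union>B), B)"])
      (use connected_graph_of_connected_from[OF sg r sub(1) A]
        connected_graph_of_connected_from[OF sg r sub(2) B] AB cA cB in auto)
qed

section \<open>Passage to subgraphs and growth of the weight\<close>

lemma local_positive_subgraph: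
  assumes "local_positive k G w" "subgraph H G"
  shows "local_positive k H w"
proof -
  have "subgraph K G" if "subgraph K H" for K
    using that assms(2) by (auto simp: subgraph_def)
  moreover have "weighing H w"
    using assms by (auto simp: local_positive_def weighing_def subgraph_def)
  ultimately show ?thesis using assms(1) unfolding local_positive_def by blast
qed

lemma max_degree_subgraph:
  assumes "connected_graph H" "subgraph H G" "simple_graph G"
  shows "max_degree H \<le> max_degree G"
proof (rule max_degree_leI[OF assms(1)])
  fix v assume v: "v \<in> verts H"
  have "vertex_degree H v \<le> vertex_degree G v"
    unfolding vertex_degree_def using assms(2) finite_edges[OF assms(3)]
    by (intro card_mono) (auto simp: subgraph_def)
  also have "\<dots> \<le> max_degree G"
    using vertex_degree_le_max_degree[OF assms(3)] v assms(2) by (auto simp: subgraph_def)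
  finally show "vertex_degree H v \<le> max_degree G" .
qed

text \<open>In the induction on \<open>j\<close>, one piece of a split graph has weight above
  \<open>j\<close> and the other has positive weight, hence at least 1. Closure under connected
  subgraphs keeps both pieces in \<open>CF\<close>.\<close>

lemma weight_tends_to_infinity:
  assumes conn: "CF \<subseteq> connected_graphs"
    and closed: "\<And>G H. G \<in> CF \<Longrightarrow> subgraph H G \<Longrightarrow> connected_graph H \<Longrightarrow> H \<in> CF"
    and pos: "\<And>G w. G \<in> CF \<Longrightarrow> m \<le> card (edges G) \<Longrightarrow> local_positive k G w \<Longrightarrow> weight w G > 0"
  shows "\<exists>m'. \<forall>G\<in>CF. m' \<le> card (edges G) \<longrightarrow> (\<forall>w. local_positive k G w \<longrightarrow> int j < weight w G)"
proof (induction j)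
  case 0
  then show ?case using pos by (intro exI[of _ m]) simp
next
  case (Suc j)
  then obtain m' where m': "\<And>G w. G \<in> CF \<Longrightarrow> m' \<le> card (edges G) \<Longrightarrow> local_positive k G w
      \<Longrightarrow> int j < weight w G" by blast
  \<comment> \<open>Each piece must pass both thresholds; \<open>Suc\<close> also provides the
    \<open>1 \<le> M\<close> that splitting demands.\<close>
  define M where "M = Suc (max m m')"
  have "int (Suc j) < weight w G"
    if G: "G \<in> CF" "3 * M \<le> card (edges G)" "local_positive k G w" for G w
  proof -
    have G': "connected_graph G" "simple_graph G"
      using conn G(1) by (auto simp: connected_graphs_def connected_graph_def)
    have "1 \<le> M" by (simp add: M_def)
    then obtain H1 H2 where H: "connected_graph H1" "connected_graph H2" "subgraph H1 G"
      "subgraph H2 G" "edges H1 \<inter> edges H2 = {}" "edges H1 \<union> edges H2 = edges G"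
      "M \<le> card (edges H1)" "M \<le> card (edges H2)"
      using split_connected_graph[OF G'(1) G(2)] by metis
    have "0 < weight w H1"
      using pos[of H1 w] closed[OF G(1) H(3,1)] local_positive_subgraph[OF G(3) H(3)] H(7)
      by (simp add: M_def)
    moreover have "int j < weight w H2"
      using m'[of H2 w] closed[OF G(1) H(4,2)] local_positive_subgraph[OF G(3) H(4)] H(8)
      by (simp add: M_def)
    moreover have "weight w G = weight w H1 + weight w H2"
      using sum.union_disjoint[of "edges H1" "edges H2" w] H finite_edges
      by (auto simp: weight_def subgraph_def)
    ultimately show ?thesis by simp
  qed
  then show ?case by blast
qed

section \<open>Transfer between families\<close>

text \<open>Stated for abstract \<open>TF\<close> and \<open>CF\<close> so that one argument serves
  both the unrestricted and the bounded-degree families.\<close>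

lemma family_transfer:
  assumes TG: "TF \<subseteq> \<G>" and GC: "\<G> \<subseteq> CF" and conn: "CF \<subseteq> connected_graphs"
    and closed: "\<And>G H. G \<in> CF \<Longrightarrow> subgraph H G \<Longrightarrow> connected_graph H \<Longrightarrow> H \<in> CF"
    and unfold: "\<And>G w. G \<in> CF \<Longrightarrow> local_positive k G w \<Longrightarrow> \<exists>T\<in>TF. \<exists>w'.
      card (edges T) = card (edges G) \<and> local_positive k T w' \<and> weight w' T = weight w G"
  shows "(forcing k TF \<longleftrightarrow> forcing k \<G>) \<and>
        (forcing k \<G> \<longrightarrow>
           (\<forall>t::real. t > 0 \<longrightarrow>
              almost_all \<G> (\<lambda>G. \<forall>w. local_positive k G w \<longrightarrow> real_of_int (weight w G) \<ge> t))) \<and>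
        (weakly_forcing k TF \<longleftrightarrow> weakly_forcing k \<G>) \<and>
        (weakly_forcing k \<G> \<longrightarrow> weak_const k TF = weak_const k \<G>) \<and>
        (collapses k TF \<longleftrightarrow> collapses k \<G>) \<and>
        (collapses k \<G> \<longrightarrow> collapse_const k TF = collapse_const k \<G>)"
proof -
  \<comment> \<open>The right-hand side does not mention \<open>F\<close>: a violation anywhere in
    \<open>CF\<close> unfolds to one in \<open>TF\<close> with equally many edges. The free
    predicate \<open>Q\<close> covers positivity and all constant lower bounds at once.\<close>
  have transfer: "almost_all F (\<lambda>G. \<forall>w. local_positive k G w \<longrightarrow> Q (weight w G)) \<longleftrightarrow>
      (\<exists>m. \<forall>G\<in>CF. m \<le> card (edges G) \<longrightarrow> (\<forall>w. local_positive k G w \<longrightarrow> Q (weight w G)))"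
    if F: "TF \<subseteq> F" "F \<subseteq> CF" for F Q
  proof -
    have "Q (weight w G)"
      if m: "\<forall>G\<in>F. m \<le> card (edges G) \<longrightarrow> (\<forall>w. local_positive k G w \<longrightarrow> Q (weight w G))"
        and G: "G \<in> CF" "m \<le> card (edges G)" "local_positive k G w" for m G w
      using unfold[OF G(1,3)] m G(2) F(1) by (metis subsetD)
    then show ?thesis
      unfolding almost_all_iff_large[OF subset_trans[OF F(2) conn]] using F(2) by blast
  qed
  have TC: "TF \<subseteq> CF" using TG GC by blast
  note trT = transfer[OF order_refl TC] and trG = transfer[OF TG GC]
  have f: "forcing k TF \<longleftrightarrow> forcing k \<G>" unfolding forcing_def trT trG ..
  have wl: "weak_lower_bound k TF = weak_lower_bound k \<G>"
    unfolding weak_lower_bound_def fun_eq_iff trT[of "\<lambda>x. _ \<le> real_of_int x"]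
      trG[of "\<lambda>x. _ \<le> real_of_int x"] by simp
  have wf: "weakly_forcing k TF \<longleftrightarrow> weakly_forcing k \<G>"
    unfolding weakly_forcing_def f wl ..
  have wc: "weak_const k TF = weak_const k \<G>" unfolding weak_const_def wl ..
  have ll: "linear_lower_bound k TF = linear_lower_bound k \<G>"
  proof
    fix c
    \<comment> \<open>The bound sees \<open>G\<close> only through its number of edges, which
      unfolding preserves, so the same error term \<open>h\<close> works for both families.\<close>
    have "(\<forall>G\<in>TF. \<forall>w. local_positive k G w \<longrightarrow>
          c * real (card (edges G)) - h (card (edges G)) \<le> real_of_int (weight w G)) \<longleftrightarrow>
        (\<forall>G\<in>\<G>. \<forall>w. local_positive k G w \<longrightarrow>
          c * real (card (edges G)) - h (card (edges G)) \<le> real_of_int (weight w G))"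
      (is "?L \<longleftrightarrow> ?R") for h
    proof
      assume L: ?L
      show ?R
      proof (intro ballI allI impI)
        fix G w assume G: "G \<in> \<G>" "local_positive k G w"
        then obtain T w' where "T \<in> TF" "card (edges T) = card (edges G)" "local_positive k T w'"
          "weight w' T = weight w G" using unfold GC by (metis subsetD)
        with L show "c * real (card (edges G)) - h (card (edges G)) \<le> real_of_int (weight w G)"
          by metis
      qed
    qed (use TG in blast)
    then show "linear_lower_bound k TF c = linear_lower_bound k \<G> c"
      unfolding linear_lower_bound_def by simp
  qed
  have cc: "collapse_const k TF = collapse_const k \<G>" unfolding collapse_const_def ll ..
  have growth: "almost_all \<G> (\<lambda>G. \<forall>w. local_positive k G w \<longrightarrow> real_of_int (weight w G) \<ge> t)"
    if "forcing k \<G>" for t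
  proof -
    obtain m where m: "\<And>G w. G \<in> CF \<Longrightarrow> m \<le> card (edges G) \<Longrightarrow> local_positive k G w
        \<Longrightarrow> weight w G > 0"
      using \<open>forcing k \<G>\<close> unfolding forcing_def trG by blast
    \<comment> \<open>The growth lemma takes natural bounds, and
      \<open>nat \<lceil>t\<rceil>\<close> is one that is at least \<open>t\<close>.\<close>
    obtain m' where m': "\<forall>G\<in>CF. m' \<le> card (edges G) \<longrightarrow>
        (\<forall>w. local_positive k G w \<longrightarrow> int (nat \<lceil>t\<rceil>) < weight w G)"
      using weight_tends_to_infinity[of CF m k "nat \<lceil>t\<rceil>", OF conn] closed m by blast
    have "t \<le> real_of_int x" if "int (nat \<lceil>t\<rceil>) < x" for x
      using that by linarith
    with m' show ?thesis unfolding trG[of "\<lambda>x. _ \<le> real_of_int x"] by blast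
  qed
  show ?thesis using f wf wc cc growth by (simp add: collapses_def)
qed

theorem theorem2p1:
  fixes k :: nat
  assumes "k \<ge> 1"
  shows
    "(\<forall>\<G>. trees \<subseteq> \<G> \<and> \<G> \<subseteq> connected_graphs \<longrightarrow>
        (forcing k trees \<longleftrightarrow> forcing k \<G>) \<and>
        (forcing k \<G> \<longrightarrow>
           (\<forall>t::real. t > 0 \<longrightarrow>
              almost_all \<G> (\<lambda>G. \<forall>w. local_positive k G w \<longrightarrow> real_of_int (weight w G) \<ge> t))) \<and>
        (weakly_forcing k trees \<longleftrightarrow> weakly_forcing k \<G>) \<and>
        (weakly_forcing k \<G> \<longrightarrow> weak_const k trees = weak_const k \<G>) \<and>
        (collapses k trees \<longleftrightarrow> collapses k \<G>) \<and>
        (collapses k \<G> \<longrightarrow> collapse_const k trees = collapse_const k \<G>))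
     \<and>
     (\<forall>(D::nat) \<G>. real D \<ge> real k / 2 - 1 \<and>
        restrict_degree trees D \<subseteq> \<G> \<and> \<G> \<subseteq> restrict_degree connected_graphs D \<longrightarrow>
        (forcing k (restrict_degree trees D) \<longleftrightarrow> forcing k \<G>) \<and>
        (forcing k \<G> \<longrightarrow>
           (\<forall>t::real. t > 0 \<longrightarrow>
              almost_all \<G> (\<lambda>G. \<forall>w. local_positive k G w \<longrightarrow> real_of_int (weight w G) \<ge> t))) \<and>
        (weakly_forcing k (restrict_degree trees D) \<longleftrightarrow> weakly_forcing k \<G>) \<and>
        (weakly_forcing k \<G> \<longrightarrow> weak_const k (restrict_degree trees D) = weak_const k \<G>) \<and>
        (collapses k (restrict_degree trees D) \<longleftrightarrow> collapses k \<G>) \<and>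
        (collapses k \<G> \<longrightarrow> collapse_const k (restrict_degree trees D) = collapse_const k \<G>))"
proof (rule conjI; intro allI impI; elim conjE)
  fix \<G> assume "trees \<subseteq> \<G>" "\<G> \<subseteq> connected_graphs"
  moreover have "\<exists>T\<in>trees. \<exists>w'. card (edges T) = card (edges G) \<and> local_positive k T w' \<and>
      weight w' T = weight w G" if "G \<in> connected_graphs" "local_positive k G w" for G w
    using unfold_to_tree[of G k w] that unfolding trees_def connected_graphs_def by blast
  ultimately show "(forcing k trees \<longleftrightarrow> forcing k \<G>) \<and>
        (forcing k \<G> \<longrightarrow>
           (\<forall>t::real. t > 0 \<longrightarrow>
              almost_all \<G> (\<lambda>G. \<forall>w. local_positive k G w \<longrightarrow> real_of_int (weight w G) \<ge> t))) \<and>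
        (weakly_forcing k trees \<longleftrightarrow> weakly_forcing k \<G>) \<and>
        (weakly_forcing k \<G> \<longrightarrow> weak_const k trees = weak_const k \<G>) \<and>
        (collapses k trees \<longleftrightarrow> collapses k \<G>) \<and>
        (collapses k \<G> \<longrightarrow> collapse_const k trees = collapse_const k \<G>)"
    by (intro family_transfer[where CF = connected_graphs]) (simp_all add: connected_graphs_def)
next
  fix D \<G>
  assume "restrict_degree trees D \<subseteq> \<G>" "\<G> \<subseteq> restrict_degree connected_graphs D"
  \<comment> \<open>Unfolding does not raise the maximum degree, so the tree stays in the bounded
    family.\<close>
  moreover have "\<exists>T\<in>restrict_degree trees D. \<exists>w'. card (edges T) = card (edges G) \<and>
      local_positive k T w' \<and> weight w' T = weight w G"
    if "G \<in> restrict_degree connected_graphs D" "local_positive k G w" for G w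
    using unfold_to_tree[of G k w] that le_trans
    unfolding trees_def connected_graphs_def restrict_degree_def by blast
  moreover have "H \<in> restrict_degree connected_graphs D"
    if "G \<in> restrict_degree connected_graphs D" "subgraph H G" "connected_graph H" for G H
    using max_degree_subgraph[OF that(3,2)] that
    by (auto simp: restrict_degree_def connected_graphs_def connected_graph_def)
  moreover have "restrict_degree connected_graphs D \<subseteq> connected_graphs"
    by (auto simp: restrict_degree_def)
  ultimately show "(forcing k (restrict_degree trees D) \<longleftrightarrow> forcing k \<G>) \<and>
        (forcing k \<G> \<longrightarrow>
           (\<forall>t::real. t > 0 \<longrightarrow>
              almost_all \<G> (\<lambda>G. \<forall>w. local_positive k G w \<longrightarrow> real_of_int (weight w G) \<ge> t))) \<and>
        (weakly_forcing k (restrict_degree trees D) \<longleftrightarrow> weakly_forcing k \<G>) \<and>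
        (weakly_forcing k \<G> \<longrightarrow> weak_const k (restrict_degree trees D) = weak_const k \<G>) \<and>
        (collapses k (restrict_degree trees D) \<longleftrightarrow> collapses k \<G>) \<and>
        (collapses k \<G> \<longrightarrow> collapse_const k (restrict_degree trees D) = collapse_const k \<G>)"
    by (intro family_transfer)
qed

end
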